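(* If $A$ is an elementary abelian $p^n$-group of ppc-rank $r$, then there are exactly $\frac{1}{6}(r+1)(r+2)(r+3)$ isomorphism classes of associative interchange rings with additive group $(A,+)$.
   Context: For a prime $p$ and integers $n,r\ge1$, an elementary abelian $p^n$-group of ppc-rank $r$ is a direct sum of $r$ copies of the cyclic group of order $p^n$. An interchange ring is a triple $(A,+,\bullet)$ where $(A,+)$ is an abelian group and $\bullet$ is a binary operation satisfying $(w+x)\bullet(y+z) = (w\bullet y)+(x\bullet z)$ for all $w,x,y,z\in A$; it is associative if $(A,\bullet)$ is associative. An isomorphism of interchange rings is a bijection that is a homomorphism for both operations. *)

theory Defs
  imports "HOL-Algebra.Algebra" "HOL-Library.FuncSet"
begin

text \<open>The abelian group (A,+) is written as a HOL-Algebra group G (multiplicative notation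
  of the library).  A binary operation on the carrier is represented as an extensional
  curried function.\<close>

definition interchange_op :: "('a, 'b) monoid_scheme \<Rightarrow> ('a \<Rightarrow> 'a \<Rightarrow> 'a) \<Rightarrow> bool" where
  "interchange_op G m \<longleftrightarrow>
     m \<in> carrier G \<rightarrow>\<^sub>E carrier G \<rightarrow>\<^sub>E carrier G \<and>
     (\<forall>w\<in>carrier G. \<forall>x\<in>carrier G. \<forall>y\<in>carrier G. \<forall>z\<in>carrier G.
        m (w \<otimes>\<^bsub>G\<^esub> x) (y \<otimes>\<^bsub>G\<^esub> z) = (m w y) \<otimes>\<^bsub>G\<^esub> (m x z))"

definition associative_op :: "('a, 'b) monoid_scheme \<Rightarrow> ('a \<Rightarrow> 'a \<Rightarrow> 'a) \<Rightarrow> bool" where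
  "associative_op G m \<longleftrightarrow>
     (\<forall>x\<in>carrier G. \<forall>y\<in>carrier G. \<forall>z\<in>carrier G. m (m x y) z = m x (m y z))"

definition assoc_interchange_rings :: "('a, 'b) monoid_scheme \<Rightarrow> ('a \<Rightarrow> 'a \<Rightarrow> 'a) set" where
  "assoc_interchange_rings G = {m. interchange_op G m \<and> associative_op G m}"

definition interchange_ring_iso ::
  "('a, 'b) monoid_scheme \<Rightarrow> ('a \<Rightarrow> 'a \<Rightarrow> 'a) \<Rightarrow> ('a \<Rightarrow> 'a \<Rightarrow> 'a) \<Rightarrow> ('a \<Rightarrow> 'a) \<Rightarrow> bool" where
  "interchange_ring_iso G m1 m2 f \<longleftrightarrow>
     f \<in> iso G G \<and> (\<forall>x\<in>carrier G. \<forall>y\<in>carrier G. f (m1 x y) = m2 (f x) (f y))"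

definition interchange_ring_isomorphic :: "('a, 'b) monoid_scheme \<Rightarrow> ('a \<Rightarrow> 'a \<Rightarrow> 'a) rel" where
  "interchange_ring_isomorphic G =
     {(m1, m2). m1 \<in> assoc_interchange_rings G \<and> m2 \<in> assoc_interchange_rings G \<and>
                (\<exists>f. interchange_ring_iso G m1 m2 f)}"

definition elem_abelian_group :: "nat \<Rightarrow> nat \<Rightarrow> nat \<Rightarrow> (nat \<Rightarrow> int) monoid" where
  "elem_abelian_group p n r = product_group {..<r} (\<lambda>_. integer_mod_group (p ^ n))"

end

theory Submission
  imports Defs
begin

text \<open>
  The interchange law says that \<open>m\<close> is a homomorphism \<open>A \<times> A \<rightarrow> A\<close>, that is,
  \<open>m x y = \<alpha> x + \<beta> y\<close> with endomorphisms \<open>\<alpha>\<close> and \<open>\<beta>\<close>; associativity says that \<open>\<alpha>\<close>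
  and \<open>\<beta>\<close> are commuting idempotents. These split \<open>A\<close> into four joint eigenspaces. A maximal
  independent set of joint eigenvectors is a basis: a vector \<open>x\<close> of an eigenspace that is outside
  the span, but with \<open>p x\<close> in the span, can be corrected by an element of the span so that
  \<open>p x = 0\<close>; then \<open>x = p\<^sup>n\<^sup>-\<^sup>1 y\<close>, where \<open>y\<close> can be projected to the same eigenspace, and
  \<open>y\<close> enlarges the set. Hence the four eigenspaces are free over \<open>\<int>/p\<^sup>n\<close>, their ranks are a
  complete isomorphism invariant, and any four ranks with sum \<open>r\<close> occur.
\<close>

section \<open>Integer combinations of families in an abelian group\<close>

context comm_group
begin

text \<open>The vectors form a family over the index set, so a homomorphism can change them while
  the coefficients stay fixed; taking \<open>id\<close> for \<open>v\<close> gives combinations of a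
  set. Over an infinite \<open>B\<close> the product defaults to \<open>\<one>\<close>.\<close>

definition comb :: "('c \<Rightarrow> int) \<Rightarrow> ('c \<Rightarrow> 'a) \<Rightarrow> 'c set \<Rightarrow> 'a"
  where "comb c v B = (\<Otimes>b\<in>B. v b [^] c b)"

lemma comb_closed [simp, intro]: "v ` B \<subseteq> carrier G \<Longrightarrow> comb c v B \<in> carrier G"
  unfolding comb_def by (rule finprod_closed) auto

lemma comb_cong:
  assumes "v ` B \<subseteq> carrier G" "\<And>b. b \<in> B \<Longrightarrow> v b [^] c b = w b [^] d b"
  shows "comb c v B = comb d w B"
proof -
  have "comb d w B = comb c v B"
    unfolding comb_def using assms by (intro finprod_cong') auto
  then show ?thesis ..
qed

lemma comb_mult:
  assumes "v ` B \<subseteq> carrier G"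
  shows "comb c v B \<otimes> comb d v B = comb (\<lambda>b. c b + d b) v B"
proof -
  have "comb (\<lambda>b. c b + d b) v B = (\<Otimes>b\<in>B. v b [^] c b \<otimes> v b [^] d b)"
    unfolding comb_def using assms by (intro finprod_cong') (auto simp: int_pow_mult)
  also have "\<dots> = comb c v B \<otimes> comb d v B"
    unfolding comb_def using assms by (intro finprod_multf) auto
  finally show ?thesis ..
qed

lemma comb_zero [simp]: "comb (\<lambda>_. 0) v B = \<one>"
  by (simp add: comb_def)

lemma comb_int_pow:
  assumes v: "v ` B \<subseteq> carrier G"
  shows "comb c v B [^] (k::int) = comb (\<lambda>b. k * c b) v B"
proof -
  have nat: "comb c v B [^] j = comb (\<lambda>b. int j * c b) v B" for j :: nat
    by (induction j) (simp_all add: comb_mult[OF v] algebra_simps)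
  have neg: "inv (comb c v B) = comb (\<lambda>b. - c b) v B" for c
    by (rule inv_equality) (simp_all add: comb_mult[OF v] comb_closed[OF v])
  show ?thesis
  proof (cases "k \<ge> 0")
    case True
    then have "k = int (nat k)" by simp
    then show ?thesis using nat[of "nat k"] int_pow_int[of _ "comb c v B" "nat k"] by metis
  next
    case False
    then have k: "- k = int (nat (- k))" by simp
    have "comb c v B [^] (- k) = comb (\<lambda>b. - k * c b) v B"
      using nat[of "nat (- k)"] int_pow_int[of _ "comb c v B" "nat (- k)"] k by metis
    then have "inv (comb c v B [^] k) = comb (\<lambda>b. - k * c b) v B"
      using comb_closed[OF v, of c] by (simp only: int_pow_neg)
    then have "comb c v B [^] k = inv (comb (\<lambda>b. - k * c b) v B)"
      using comb_closed[OF v, of c] by (metis int_pow_closed inv_inv)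
    then show ?thesis unfolding neg by simp
  qed
qed

lemma comb_inv:
  assumes "v ` B \<subseteq> carrier G"
  shows "inv (comb c v B) = comb (\<lambda>b. - c b) v B"
  using comb_int_pow[OF assms, of c "-1"] int_pow_neg[of "comb c v B" 1] assms by simp

lemma comb_insert:
  assumes "finite B" "b \<notin> B" "v ` insert b B \<subseteq> carrier G"
  shows "comb c v (insert b B) = v b [^] c b \<otimes> comb c v B"
  unfolding comb_def using assms by (intro finprod_insert) auto

lemma comb_reindex:
  assumes "bij_betw \<phi> A B" "v ` B \<subseteq> carrier G"
  shows "comb c v B = comb (\<lambda>a. c (\<phi> a)) (\<lambda>a. v (\<phi> a)) A"
proof -
  have B: "B = \<phi> ` A" and inj: "inj_on \<phi> A" using assms(1) by (auto simp: bij_betw_def)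
  show ?thesis unfolding comb_def B
    using assms(2) by (intro finprod_reindex) (auto simp: B inj)
qed

lemma hom_comb:
  assumes h: "h \<in> hom G G" and v: "v ` B \<subseteq> carrier G" and fin: "finite B"
  shows "h (comb c v B) = comb c (\<lambda>b. h (v b)) B"
  using fin v
proof (induction B rule: finite_induct)
  case empty
  then show ?case using h by (simp add: comb_def hom_one)
next
  case (insert b B)
  have hv: "(\<lambda>b. h (v b)) ` insert b B \<subseteq> carrier G"
    using insert.prems h by (auto simp: hom_def)
  have "h (comb c v (insert b B)) = h (v b [^] c b) \<otimes> h (comb c v B)"
    using insert h by (simp add: comb_insert hom_mult)
  also have "h (v b [^] c b) = h (v b) [^] c b"
    using insert.prems h hom_int_pow[of h G G "v b" "c b"] by (simp add: is_group)
  finally show ?case using insert hv by (simp add: comb_insert)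
qed

text \<open>Removing a vector has the same effect as removing its coefficient. This turns the action
  of a projection on eigenvectors into an operation on coordinates.\<close>

lemma comb_select:
  assumes "v ` B \<subseteq> carrier G"
  shows "comb c (\<lambda>b. if P b then v b else \<one>) B = comb (\<lambda>b. if P b then c b else 0) v B"
  using assms by (intro comb_cong) auto

lemma comb_delta:
  assumes "finite B" "b \<in> B" "v ` B \<subseteq> carrier G"
  shows "comb (\<lambda>a. if a = b then 1 else 0) v B = v b"
proof -
  have "comb (\<lambda>a. if a = b then 1 else 0) v B = (\<Otimes>a\<in>B. if b = a then v a else \<one>)"
    unfolding comb_def using assms(3) by (intro finprod_cong') auto
  also have "\<dots> = v b" using assms by (intro finprod_singleton) auto
  finally show ?thesis .
qed

end

text \<open>The condition on elements killed by \<open>p\<close> expresses homocyclicity; unlike a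
  direct-sum decomposition, it is visibly inherited by direct summands.\<close>

locale homocyclic_group = comm_group G for G (structure) +
  fixes p n r :: nat
  assumes prime_p: "Factorial_Ring.prime p"
    and n_pos: "n \<ge> 1"
    and finite_carrier: "finite (carrier G)"
    and card_carrier: "card (carrier G) = (p ^ n) ^ r"
    and exponent: "x \<in> carrier G \<Longrightarrow> x [^] (p ^ n) = \<one>"
    and socle: "\<lbrakk>x \<in> carrier G; x [^] p = \<one>\<rbrakk> \<Longrightarrow> \<exists>y\<in>carrier G. x = y [^] (p ^ (n - 1))"
begin

section \<open>Independence and span over the integers modulo p^n\<close>

definition q :: nat where "q = p ^ n"

lemma q_gt_1: "q > 1"
  unfolding q_def by (rule one_less_power) (use prime_gt_1_nat[OF prime_p] n_pos in auto)

lemma int_exponent: "x \<in> carrier G \<Longrightarrow> int q dvd k \<Longrightarrow> x [^] k = \<one>"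
  by (metis dvdE exponent int_pow_int int_pow_one int_pow_pow q_def)

lemma int_pow_cong_mod:
  assumes "x \<in> carrier G" "int q dvd k - l"
  shows "x [^] k = x [^] (l::int)"
proof -
  have "x [^] k = x [^] (l + (k - l))" by simp
  also have "\<dots> = x [^] l \<otimes> x [^] (k - l)" using assms(1) by (intro int_pow_mult)
  finally show ?thesis using int_exponent[OF assms] assms(1) by simp
qed

text \<open>Linear independence over the integers modulo \<open>q\<close>, with integers
  representing the coefficients. Every element of an independent set thus has order exactly
  \<open>q\<close>.\<close>

definition independent :: "'a set \<Rightarrow> bool" where
  "independent B \<longleftrightarrow> B \<subseteq> carrier G \<and> (\<forall>c. comb c id B = \<one> \<longrightarrow> (\<forall>b\<in>B. int q dvd c b))"

definition span :: "'a set \<Rightarrow> 'a set" where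
  "span B = range (\<lambda>c. comb c id B)"

lemma independent_finite: "independent B \<Longrightarrow> finite B"
  using finite_carrier finite_subset by (auto simp: independent_def)

lemma independent_carrier: "independent B \<Longrightarrow> id ` B \<subseteq> carrier G"
  by (auto simp: independent_def)

lemma independent_empty: "independent {}"
  by (simp add: independent_def)

lemma independent_subset:
  assumes B: "independent B" and A: "A \<subseteq> B"
  shows "independent A"
  unfolding independent_def
proof (intro conjI allI impI ballI)
  show "A \<subseteq> carrier G" using assms by (auto simp: independent_def)
  fix c b assume c: "comb c id A = \<one>" and b: "b \<in> A"
  \<comment> \<open>A relation on \<open>A\<close> becomes one on \<open>B\<close> when extended by
    zero coefficients.\<close>
  have "comb (\<lambda>b. if b \<in> A then c b else 0) id B = comb c id A"
    unfolding comb_def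
    by (rule finprod_mono_neutral_cong_right)
       (use independent_finite[OF B] independent_carrier[OF B] A in auto)
  then have "int q dvd (if b \<in> A then c b else 0)"
    using B b A c unfolding independent_def by (metis (mono_tags, lifting) subsetD)
  then show "int q dvd c b" using b by simp
qed

lemma comb_eq_iff:
  assumes B: "independent B"
  shows "comb c id B = comb d id B \<longleftrightarrow> (\<forall>b\<in>B. int q dvd c b - d b)"
proof
  note cl = independent_carrier[OF B]
  assume "comb c id B = comb d id B"
  then have "comb c id B \<otimes> inv (comb d id B) = \<one>" using cl by (simp add: r_inv)
  then have "comb (\<lambda>b. c b - d b) id B = \<one>" using cl by (simp add: comb_inv comb_mult)
  then show "\<forall>b\<in>B. int q dvd c b - d b"
    using B unfolding independent_def by blast
next
  assume "\<forall>b\<in>B. int q dvd c b - d b"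
  then show "comb c id B = comb d id B"
    using independent_carrier[OF B] by (intro comb_cong) (auto intro: int_pow_cong_mod)
qed

lemma span_subgroup:
  assumes "B \<subseteq> carrier G"
  shows "subgroup (span B) G"
proof (rule subgroupI)
  have B: "id ` B \<subseteq> carrier G" using assms by simp
  show "span B \<subseteq> carrier G" using B by (auto simp: span_def)
  show "span B \<noteq> {}" by (auto simp: span_def)
  show "inv a \<in> span B" if "a \<in> span B" for a
    using that by (auto simp: span_def comb_inv[OF B])
  show "a \<otimes> b \<in> span B" if "a \<in> span B" "b \<in> span B" for a b
    using that by (auto simp: span_def comb_mult[OF B])
qed

lemma span_superset:
  assumes "B \<subseteq> carrier G"
  shows "B \<subseteq> span B"
proof
  fix b assume b: "b \<in> B"
  have "comb (\<lambda>a. if a = b then 1 else 0) id B = b"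
    using comb_delta[of B b id] b assms finite_subset[OF assms finite_carrier] by simp
  then show "b \<in> span B" unfolding span_def by (metis rangeI)
qed

text \<open>Reduction modulo \<open>q\<close> gives each element of the span exactly one coefficient
  function with values in \<open>{0..<int q}\<close>, so it suffices to count these
  functions.\<close>

lemma card_span:
  assumes B: "independent B"
  shows "card (span B) = q ^ card B"
proof -
  let ?C = "B \<rightarrow>\<^sub>E {0..<int q}"
  have "inj_on (\<lambda>c. comb c id B) ?C"
  proof (rule inj_onI)
    fix c d assume c: "c \<in> ?C" and d: "d \<in> ?C" and "comb c id B = comb d id B"
    then have "\<forall>b\<in>B. int q dvd c b - d b" using comb_eq_iff[OF B] by blast
    then have "c b = d b" if "b \<in> B" for b
      using PiE_mem[OF c that] PiE_mem[OF d that] that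
      by (metis atLeastLessThan_iff mod_eq_dvd_iff mod_pos_pos_trivial)
    then show "c = d" using PiE_ext[OF c d] by blast
  qed
  moreover have "(\<lambda>c. comb c id B) ` ?C = span B"
  proof (intro subset_antisym subsetI)
    fix x assume "x \<in> span B"
    then obtain c where x: "x = comb c id B" by (auto simp: span_def)
    let ?d = "\<lambda>b\<in>B. c b mod int q"
    have "comb ?d id B = x" unfolding x comb_eq_iff[OF B]
      by (auto simp: mod_eq_dvd_iff[symmetric])
    moreover have "?d \<in> ?C" using q_gt_1 by auto
    ultimately show "x \<in> (\<lambda>c. comb c id B) ` ?C" by blast
  qed (auto simp: span_def)
  ultimately have "card (span B) = card ?C" by (metis card_image)
  also have "\<dots> = q ^ card B" using independent_finite[OF B] by (simp add: card_PiE)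
  finally show ?thesis .
qed

section \<open>Bases, and bases of joint eigenvectors\<close>

definition basis :: "'a set \<Rightarrow> bool" where
  "basis B \<longleftrightarrow> independent B \<and> span B = carrier G"

lemma card_basis: "basis B \<Longrightarrow> card B = r"
  using card_span[of B] card_carrier q_gt_1 by (auto simp: basis_def simp flip: q_def)

text \<open>The exponents that take \<open>y\<close> into the span form an ideal of the integers
  containing \<open>q\<close>, hence generated by a power of p. As p^(n-1) is not in it, the
  generator is p^n. So \<open>q\<close> divides the coefficient of \<open>y\<close> in any relation,
  and a relation on \<open>B\<close> remains.\<close>

lemma independent_insert:
  assumes B: "independent B" and y: "y \<in> carrier G" and nspan: "y [^] (p ^ (n - 1)) \<notin> span B"
  shows "independent (insert y B)"
  unfolding independent_def
proof (intro conjI allI impI)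
  have Bc: "B \<subseteq> carrier G" using B by (simp add: independent_def)
  interpret S: subgroup "span B" G using span_subgroup[OF Bc] .
  have pow_span: "x [^] k \<in> span B" if "x \<in> span B" for x and k :: int
    using that S.subgroup_axioms subgroup_int_pow_closed by blast
  show "insert y B \<subseteq> carrier G" using Bc y by simp
  fix c assume eq: "comb c id (insert y B) = \<one>"
  have "y \<notin> B" using nspan span_superset[OF Bc] pow_span[of y "int (p ^ (n - 1))"]
    by (auto simp: int_pow_int simp del: of_nat_power)
  then have split: "y [^] c y \<otimes> comb c id B = \<one>"
    using comb_insert[of B y id c] eq y Bc independent_finite[OF B] by simp
  then have "y [^] c y = inv (comb c id B)" using y Bc by (simp add: inv_equality)
  then have cy: "y [^] c y \<in> span B" using Bc by (simp add: span_def comb_inv)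
  have "int q dvd c y"
  proof -
    \<comment> \<open>By Bezout the gcd of \<open>c y\<close> and \<open>q\<close> also takes
      \<open>y\<close> into the span; dividing p^n, it is some p^j, and j < n would make it divide
      p^(n-1).\<close>
    obtain u v where uv: "u * c y + v * int q = gcd (c y) (int q)" using bezout_int by blast
    have "y [^] gcd (c y) (int q) = y [^] (c y * u) \<otimes> y [^] (v * int q)"
      unfolding uv[symmetric] using y by (subst int_pow_mult) (auto simp: mult.commute)
    also have "\<dots> = (y [^] c y) [^] u" using y int_exponent[OF y] by (simp add: int_pow_pow)
    finally have g: "y [^] gcd (c y) (int q) \<in> span B" using pow_span[OF cy] by simp
    have "int (nat (gcd (c y) (int q))) dvd int q" by simp
    then have "nat (gcd (c y) (int q)) dvd p ^ n" unfolding q_def int_dvd_int_iff .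
    then obtain j where j: "j \<le> n" "nat (gcd (c y) (int q)) = p ^ j"
      using divides_primepow_nat[OF prime_p] by blast
    have "gcd (c y) (int q) = int (nat (gcd (c y) (int q)))" by simp
    then have gj: "gcd (c y) (int q) = int (p ^ j)" unfolding j(2) .
    have "j = n"
    proof (rule ccontr)
      assume "j \<noteq> n"
      then have "p ^ (n - 1) = p ^ j * p ^ (n - 1 - j)" using j by (simp flip: power_add)
      then have "y [^] (p ^ (n - 1)) = (y [^] int (p ^ j)) [^] int (p ^ (n - 1 - j))"
        using y by (simp only: nat_pow_pow int_pow_int)
      then show False using nspan pow_span[OF g, of "int (p ^ (n - 1 - j))"] unfolding gj by simp
    qed
    then have "gcd (c y) (int q) = int q" using gj by (simp add: q_def)
    then show ?thesis by (metis gcd_dvd1)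
  qed
  moreover from this have "comb c id B = \<one>"
    using split int_exponent[OF y] Bc by simp
  ultimately show "\<forall>b\<in>insert y B. int q dvd c b" using B by (auto simp: independent_def)
qed

text \<open>Here \<open>e\<close> is a complete family of orthogonal projections. Some component of
  a vector outside the span is itself outside; a p-power multiple of it, corrected within the span,
  is killed by p, and \<open>socle\<close> then supplies the new vector after projection.\<close>

lemma eigenvector_extension:
  fixes e :: "'s::finite \<Rightarrow> 'a \<Rightarrow> 'a"
  assumes hom: "\<And>s. e s \<in> hom G G"
    and orth: "\<And>s t x. x \<in> carrier G \<Longrightarrow> e s (e t x) = (if s = t then e s x else \<one>)"
    and total: "\<And>x. x \<in> carrier G \<Longrightarrow> (\<Otimes>s\<in>UNIV. e s x) = x"
    and B: "independent B" and eigen: "\<forall>b\<in>B. \<exists>s. e s b = b"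
    and proper: "span B \<noteq> carrier G"
  shows "\<exists>y s. y \<notin> B \<and> e s y = y \<and> independent (insert y B)"
proof -
  have Bc: "B \<subseteq> carrier G" and idB: "id ` B \<subseteq> carrier G" and fin: "finite B"
    using B independent_finite[OF B] by (auto simp: independent_def)
  interpret S: subgroup "span B" G using span_subgroup[OF Bc] .
  have pow_span: "x [^] k \<in> span B" if "x \<in> span B" for x and k :: int
    using that S.subgroup_axioms subgroup_int_pow_closed by blast
  have closed: "e s x \<in> carrier G" if "x \<in> carrier G" for s x
    using hom that by (auto simp: hom_def)
  have e_pow: "e s (x [^] k) = e s x [^] k" if "x \<in> carrier G" for s x and k :: nat
    using hom_nat_pow[OF hom that] by (simp add: is_group)
  \<comment> \<open>Each vector of \<open>B\<close> is fixed by \<open>e s\<close> or killed by it,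
    so \<open>e s\<close> only deletes terms of a combination.\<close>
  have e_span: "e s x \<in> span B" if x: "x \<in> span B" for s x
  proof -
    obtain c where c: "x = comb c id B" using x by (auto simp: span_def)
    have "e s x = comb c (\<lambda>b. e s b) B" unfolding c using hom_comb[OF hom idB fin] by simp
    also have "\<dots> = comb c (\<lambda>b. if e s b = b then id b else \<one>) B"
    proof (rule comb_cong)
      show "e s ` B \<subseteq> carrier G" using closed Bc by blast
      fix b assume b: "b \<in> B"
      then obtain t where "e t b = b" using eigen by blast
      then have "e s b = (if s = t then b else \<one>)" using orth[of b s t] b Bc by auto
      then show "e s b [^] c b = (if e s b = b then id b else \<one>) [^] c b" by auto
    qed
    finally show ?thesis unfolding comb_select[OF idB] span_def by simp
  qed
  obtain x where x: "x \<in> carrier G" "x \<notin> span B" using proper S.subset by blast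
  have "\<exists>s. e s x \<notin> span B"
  proof (rule ccontr)
    assume "\<not> (\<exists>s. e s x \<notin> span B)"
    then have *: "e s x \<in> span B" for s by blast
    have "finite A \<Longrightarrow> (\<Otimes>s\<in>A. e s x) \<in> span B" for A
      by (induction A rule: finite_induct) (use * closed[OF x(1)] in auto)
    then show False using total[OF x(1)] x(2) by (metis finite)
  qed
  then obtain s where s: "e s x \<notin> span B" by blast
  \<comment> \<open>The least \<open>k\<close> is at most \<open>n\<close> by the exponent of the
    group and is positive by the choice of \<open>s\<close>. One step earlier, \<open>z\<close> is
    still outside the span although \<open>z [^] p\<close> is inside.\<close>
  define k where "k = (LEAST k. e s x [^] (p ^ k) \<in> span B)"
  have k: "e s x [^] (p ^ k) \<in> span B"
    unfolding k_def by (rule LeastI[of _ n]) (simp add: exponent closed x)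
  have "k \<noteq> 0" using k s closed[OF x(1)] by (cases k) auto
  define z where "z = e s x [^] (p ^ (k - 1))"
  have z: "z \<in> carrier G" by (simp add: z_def closed x)
  have "z \<notin> span B" unfolding z_def
    using not_less_Least[of "k - 1" "\<lambda>k. e s x [^] (p ^ k) \<in> span B"] \<open>k \<noteq> 0\<close>
    unfolding k_def[symmetric] by auto
  have "p ^ k = p ^ (k - 1) * p" using \<open>k \<noteq> 0\<close> by (cases k) auto
  then have "z [^] p \<in> span B" using k closed[OF x(1)] by (simp add: z_def nat_pow_pow)
  then obtain c where c: "z [^] p = comb c id B" by (auto simp: span_def)
  have ez: "e s z = z" unfolding z_def by (simp add: e_pow closed x orth)
  have pn: "p * p ^ (n - 1) = p ^ n" using n_pos by (cases n) auto
  \<comment> \<open>Raising \<open>z [^] p\<close> to the power p^(n-1) gives \<open>\<one>\<close>,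
    so p^n divides every p^(n-1) * \<open>c b\<close>. Hence the coefficients can be divided by p,
    which yields a p-th root \<open>w\<close> of \<open>z [^] p\<close> in the span.\<close>
  have p_dvd: "int p dvd c b" if "b \<in> B" for b
  proof -
    have "comb (\<lambda>b. int (p ^ (n - 1)) * c b) id B = comb c id B [^] int (p ^ (n - 1))"
      by (simp only: comb_int_pow[OF idB])
    also have "\<dots> = (z [^] p) [^] (p ^ (n - 1))" by (simp only: c int_pow_int)
    also have "\<dots> = \<one>" using z exponent by (simp only: nat_pow_pow pn)
    finally have "int q dvd int (p ^ (n - 1)) * c b"
      using B that unfolding independent_def by blast
    then have "int (p ^ (n - 1)) * int p dvd int (p ^ (n - 1)) * c b"
      by (simp add: q_def flip: pn)
    then show ?thesis using prime_gt_0_nat[OF prime_p] by simp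
  qed
  define w where "w = comb (\<lambda>b. c b div int p) id B"
  have w: "w \<in> carrier G" "w \<in> span B" using idB by (auto simp: w_def span_def)
  have "w [^] p = w [^] int p" by (simp only: int_pow_int)
  also have "\<dots> = comb c id B"
    unfolding w_def comb_int_pow[OF idB] using p_dvd by (intro comb_cong) (use Bc in auto)
  finally have wp: "w [^] p = z [^] p" by (simp add: c)
  \<comment> \<open>Correcting by \<open>e s w\<close> instead of \<open>w\<close> keeps
    \<open>x'\<close> fixed by \<open>e s\<close>. The p-th power is still that of \<open>z\<close>,
    because \<open>z\<close> is fixed by \<open>e s\<close>.\<close>
  define x' where "x' = z \<otimes> inv (e s w)"
  have x': "x' \<in> carrier G" using z w closed by (simp add: x'_def)
  have "z = x' \<otimes> e s w" using z w closed by (simp add: x'_def m_assoc)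
  then have x'_span: "x' \<notin> span B" using \<open>z \<notin> span B\<close> e_span[OF w(2)] by auto
  have "e s w [^] p = z [^] p" using wp ez e_pow[of w s p] e_pow[of z s p] w z by simp
  then have "x' [^] p = \<one>"
    using z w closed by (simp add: x'_def nat_pow_distrib nat_pow_inv)
  then obtain y0 where y0: "y0 \<in> carrier G" "x' = y0 [^] (p ^ (n - 1))" using socle x' by blast
  \<comment> \<open>The root \<open>y0\<close> need not be an eigenvector, but its projection is
    one, with the same power since \<open>x'\<close> is fixed by \<open>e s\<close>.\<close>
  define y where "y = e s y0"
  have y: "y \<in> carrier G" "e s y = y" using y0 closed by (auto simp: y_def orth)
  have "e s x' = x'"
  proof -
    have "e s x' = e s z \<otimes> e s (inv (e s w))"
      unfolding x'_def using hom z w closed by (intro hom_mult) auto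
    also have "e s (inv (e s w)) = inv (e s (e s w))"
      using group_hom.hom_inv[of G G "e s" "e s w"] hom w closed
      by (simp add: group_hom_def group_hom_axioms_def is_group)
    finally show ?thesis using ez w orth by (simp add: x'_def)
  qed
  then have yx: "y [^] (p ^ (n - 1)) = x'" using y0 e_pow[of y0 s "p ^ (n - 1)"] by (simp add: y_def)
  then have "independent (insert y B)" using independent_insert[OF B y(1)] x'_span by simp
  moreover have "y \<notin> B"
  proof
    assume "y \<in> B"
    then have "y [^] int (p ^ (n - 1)) \<in> span B" using pow_span span_superset[OF Bc] by blast
    then show False using yx x'_span by (simp only: int_pow_int)
  qed
  ultimately show ?thesis using y by blast
qed

text \<open>By finiteness there is a maximal independent set of eigenvectors, and
  \<open>eigenvector_extension\<close> forces it to span.\<close>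

lemma eigenbasis_of_projections:
  fixes e :: "'s::finite \<Rightarrow> 'a \<Rightarrow> 'a"
  assumes "\<And>s. e s \<in> hom G G"
    and "\<And>s t x. x \<in> carrier G \<Longrightarrow> e s (e t x) = (if s = t then e s x else \<one>)"
    and "\<And>x. x \<in> carrier G \<Longrightarrow> (\<Otimes>s\<in>UNIV. e s x) = x"
  shows "\<exists>B. basis B \<and> (\<forall>b\<in>B. \<exists>s. e s b = b)"
proof -
  define F where "F = {B. independent B \<and> (\<forall>b\<in>B. \<exists>s. e s b = b)}"
  have "F \<subseteq> Pow (carrier G)" by (auto simp: F_def independent_def)
  then have "finite F" using finite_carrier by (meson finite_Pow_iff finite_subset)
  moreover have "{} \<in> F" by (simp add: F_def independent_empty)
  ultimately obtain B where B: "B \<in> F" and max: "\<And>B'. B' \<in> F \<Longrightarrow> B \<subseteq> B' \<Longrightarrow> B' = B"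
    by (metis empty_iff finite_has_maximal)
  have "span B = carrier G"
  proof (rule ccontr)
    assume "span B \<noteq> carrier G"
    then obtain y s where "y \<notin> B" "e s y = y" "independent (insert y B)"
      using eigenvector_extension[OF assms, where B = B] B by (auto simp: F_def)
    then show False using max[of "insert y B"] B by (auto simp: F_def)
  qed
  then show ?thesis using B by (auto simp: F_def basis_def)
qed

text \<open>The four products of \<alpha> or its complement with \<beta> or its complement are
  complete orthogonal projections. The label \<open>t b\<close> records the two eigenvalues of
  \<open>b\<close>, with \<open>True\<close> for 1 and \<open>False\<close> for 0.\<close>

lemma eigenbasis_of_commuting_idempotents:
  assumes \<alpha>: "\<alpha> \<in> hom G G" and \<beta>: "\<beta> \<in> hom G G"
    and \<alpha>\<alpha>: "\<And>x. x \<in> carrier G \<Longrightarrow> \<alpha> (\<alpha> x) = \<alpha> x"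
    and \<beta>\<beta>: "\<And>x. x \<in> carrier G \<Longrightarrow> \<beta> (\<beta> x) = \<beta> x"
    and \<alpha>\<beta>: "\<And>x. x \<in> carrier G \<Longrightarrow> \<alpha> (\<beta> x) = \<beta> (\<alpha> x)"
  shows "\<exists>B t. basis B \<and> (\<forall>b\<in>B. \<alpha> b = (if fst (t b) then b else \<one>)
                             \<and> \<beta> b = (if snd (t b) then b else \<one>))"
proof -
  \<comment> \<open>Written additively, \<open>pr True h\<close> is h and \<open>pr False h\<close>
    is the complementary idempotent 1 - h.\<close>
  define pr where "pr i h x = (if i then h x else x \<otimes> inv (h x))" for i and h :: "'a \<Rightarrow> 'a" and x
  have hcl: "h x \<in> carrier G" if "h \<in> hom G G" "x \<in> carrier G" for h x
    using that by (auto simp: hom_def)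
  have hinv: "h (inv x) = inv (h x)" if "h \<in> hom G G" "x \<in> carrier G" for h x
    using group_hom.hom_inv[of G G h x] that by (simp add: group_hom_def group_hom_axioms_def is_group)
  have pr_hom: "pr i h \<in> hom G G" if h: "h \<in> hom G G" for i h
  proof (rule homI)
    show "pr i h x \<in> carrier G" if "x \<in> carrier G" for x
      using that hcl[OF h] by (simp add: pr_def)
    show "pr i h (x \<otimes> y) = pr i h x \<otimes> pr i h y" if "x \<in> carrier G" "y \<in> carrier G" for x y
      using that hcl[OF h] hom_mult[OF h] by (simp add: pr_def inv_mult m_ac)
  qed
  have pr_orth: "pr i h (pr j h x) = (if i = j then pr i h x else \<one>)"
    if h: "h \<in> hom G G" "\<And>x. x \<in> carrier G \<Longrightarrow> h (h x) = h x" and x: "x \<in> carrier G" for i j h x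
    using hcl[OF h(1)] hom_mult[OF h(1)] hinv[OF h(1)] h(2) x by (auto simp: pr_def)
  have pr_total: "pr True h x \<otimes> pr False h x = x" if "h \<in> hom G G" "x \<in> carrier G" for h x
    using hcl that by (simp add: pr_def m_ac)
  have pr_comm: "pr i \<alpha> (pr j \<beta> x) = pr j \<beta> (pr i \<alpha> x)" if x: "x \<in> carrier G" for i j x
    using hcl[OF \<alpha>] hcl[OF \<beta>] hom_mult[OF \<alpha>] hom_mult[OF \<beta>] hinv[OF \<alpha>] hinv[OF \<beta>] \<alpha>\<beta> x
    by (auto simp: pr_def inv_mult m_ac)
  have pr_cl: "pr i h x \<in> carrier G" if "h \<in> hom G G" "x \<in> carrier G" for i h x
    using hcl[OF pr_hom] that by blast
  define e where "e s x = pr (fst s) \<alpha> (pr (snd s) \<beta> x)" for s :: "bool \<times> bool" and x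
  have "\<exists>B. basis B \<and> (\<forall>b\<in>B. \<exists>s. e s b = b)"
  proof (rule eigenbasis_of_projections)
    show "e s \<in> hom G G" for s
      using pr_hom[OF \<alpha>, of "fst s"] pr_hom[OF \<beta>, of "snd s"] by (auto simp: e_def hom_def Pi_iff)
    show "e s (e t x) = (if s = t then e s x else \<one>)" if x: "x \<in> carrier G" for s t x
    proof -
      have "e s (e t x) = pr (fst s) \<alpha> (pr (fst t) \<alpha> (pr (snd s) \<beta> (pr (snd t) \<beta> x)))"
        unfolding e_def using x pr_cl \<alpha> \<beta> pr_comm by simp
      also have "\<dots> = (if s = t then e s x else \<one>)"
        using x pr_cl pr_orth[OF \<alpha> \<alpha>\<alpha>] pr_orth[OF \<beta> \<beta>\<beta>] \<alpha> \<beta> hom_one[OF pr_hom[OF \<alpha>]]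
        by (auto simp: e_def prod_eq_iff is_group)
      finally show ?thesis .
    qed
    show "(\<Otimes>s\<in>UNIV. e s x) = x" if x: "x \<in> carrier G" for x
    proof -
      have cl: "e s x \<in> carrier G" for s using pr_cl \<alpha> \<beta> x by (simp add: e_def)
      have U: "(UNIV :: (bool \<times> bool) set) = {(True,True),(False,True),(True,False),(False,False)}"
        by (auto simp: UNIV_bool)
      \<comment> \<open>The grouping adds up the two \<alpha>-components for each fixed
        \<beta>-component first.\<close>
      have "(\<Otimes>s\<in>UNIV. e s x) = (e (True,True) x \<otimes> e (False,True) x)
          \<otimes> (e (True,False) x \<otimes> e (False,False) x)"
        unfolding U using cl by (simp add: m_ac)
      also have "\<dots> = pr True \<beta> x \<otimes> pr False \<beta> x"
        unfolding e_def using pr_total[OF \<alpha>] pr_cl[OF \<beta> x] by simp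
      finally show ?thesis using pr_total[OF \<beta> x] by simp
    qed
  qed
  then obtain B t where B: "basis B" and t: "\<And>b. b \<in> B \<Longrightarrow> e (t b) b = b" by metis
  have "\<alpha> b = (if fst (t b) then b else \<one>) \<and> \<beta> b = (if snd (t b) then b else \<one>)" if b: "b \<in> B" for b
  proof
    have bc: "b \<in> carrier G" using B b by (auto simp: basis_def independent_def)
    have pr1: "pr True h x = h x" for h x by (simp add: pr_def)
    have "\<alpha> b = pr True \<alpha> (pr (fst (t b)) \<alpha> (pr (snd (t b)) \<beta> b))"
      using t[OF b] by (simp add: e_def pr1)
    also have "\<dots> = (if fst (t b) then e (t b) b else \<one>)"
      using pr_orth[OF \<alpha> \<alpha>\<alpha>] pr_cl[OF \<beta> bc] by (auto simp: e_def)
    finally show "\<alpha> b = (if fst (t b) then b else \<one>)" using t[OF b] by simp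
    \<comment> \<open>Commutation moves the \<beta>-projection to the outside, where orthogonality
      applies to it.\<close>
    have eb: "pr (snd (t b)) \<beta> (pr (fst (t b)) \<alpha> b) = b"
      using t[OF b] pr_comm[OF bc] by (simp add: e_def)
    then have "\<beta> b = pr True \<beta> (pr (snd (t b)) \<beta> (pr (fst (t b)) \<alpha> b))"
      by (simp add: pr1)
    also have "\<dots> = (if snd (t b) then pr (snd (t b)) \<beta> (pr (fst (t b)) \<alpha> b) else \<one>)"
      using pr_orth[OF \<beta> \<beta>\<beta>] pr_cl[OF \<alpha> bc] by auto
    finally show "\<beta> b = (if snd (t b) then b else \<one>)" by (simp only: eb)
  qed
  then show ?thesis using B by blast
qed

end

section \<open>Associative interchange rings as pairs of commuting idempotents\<close>

context comm_group
begin

text \<open>The splitting comes from writing (x, y) as the product of (x, 1) and (1, y). The last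
  three identities are associativity on the triples (x, 1, 1), (1, 1, x) and (1, x, 1), together
  with \<open>m \<one> \<one> = \<one>\<close>.\<close>

lemma assoc_interchange_ring_decompose:
  assumes m: "m \<in> assoc_interchange_rings G"
  shows "(\<lambda>x. m x \<one>) \<in> hom G G" "(\<lambda>x. m \<one> x) \<in> hom G G"
    and "\<And>x y. \<lbrakk>x \<in> carrier G; y \<in> carrier G\<rbrakk> \<Longrightarrow> m x y = m x \<one> \<otimes> m \<one> y"
    and "\<And>x. x \<in> carrier G \<Longrightarrow> m (m x \<one>) \<one> = m x \<one>"
    and "\<And>x. x \<in> carrier G \<Longrightarrow> m \<one> (m \<one> x) = m \<one> x"
    and "\<And>x. x \<in> carrier G \<Longrightarrow> m (m \<one> x) \<one> = m \<one> (m x \<one>)"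
proof -
  have cl: "m x y \<in> carrier G" if "x \<in> carrier G" "y \<in> carrier G" for x y
  proof -
    have "m \<in> carrier G \<rightarrow>\<^sub>E carrier G \<rightarrow>\<^sub>E carrier G"
      using m by (simp add: assoc_interchange_rings_def interchange_op_def)
    then have "m x \<in> carrier G \<rightarrow>\<^sub>E carrier G" using that(1) by (rule PiE_mem)
    then show ?thesis using that(2) by (rule PiE_mem)
  qed
  have ic: "m (w \<otimes> x) (y \<otimes> z) = m w y \<otimes> m x z"
    if "w \<in> carrier G" "x \<in> carrier G" "y \<in> carrier G" "z \<in> carrier G" for w x y z
    using m that by (simp add: assoc_interchange_rings_def interchange_op_def)
  have as: "m (m x y) z = m x (m y z)"
    if "x \<in> carrier G" "y \<in> carrier G" "z \<in> carrier G" for x y z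
    using m that by (simp add: assoc_interchange_rings_def associative_op_def)
  show homs: "(\<lambda>x. m x \<one>) \<in> hom G G" "(\<lambda>x. m \<one> x) \<in> hom G G"
    using cl ic[of _ _ \<one> \<one>] ic[of \<one> \<one>] by (auto simp: hom_def)
  have one: "m \<one> \<one> = \<one>" using hom_one[OF homs(1)] by (simp add: is_group)
  show decomp: "m x y = m x \<one> \<otimes> m \<one> y" if "x \<in> carrier G" "y \<in> carrier G" for x y
    using ic[of x \<one> \<one> y] that by simp
  show "m (m x \<one>) \<one> = m x \<one>" if "x \<in> carrier G" for x
    using as[of x \<one> \<one>] that by (simp add: one)
  show "m \<one> (m \<one> x) = m \<one> x" if "x \<in> carrier G" for x
    using as[of \<one> \<one> x] that by (simp add: one)
  show "m (m \<one> x) \<one> = m \<one> (m x \<one>)" if "x \<in> carrier G" for x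
    using as[of \<one> x \<one>] that by simp
qed

text \<open>Converse of the decomposition: both bracketings of three elements expand to
  \<open>\<alpha> x \<otimes> \<alpha> (\<beta> y) \<otimes> \<beta> z\<close>. The restrictions
  make the operation extensional.\<close>

lemma assoc_interchange_ring_of_idempotents:
  assumes \<alpha>: "\<alpha> \<in> hom G G" and \<beta>: "\<beta> \<in> hom G G"
    and \<alpha>\<alpha>: "\<And>x. x \<in> carrier G \<Longrightarrow> \<alpha> (\<alpha> x) = \<alpha> x"
    and \<beta>\<beta>: "\<And>x. x \<in> carrier G \<Longrightarrow> \<beta> (\<beta> x) = \<beta> x"
    and \<alpha>\<beta>: "\<And>x. x \<in> carrier G \<Longrightarrow> \<alpha> (\<beta> x) = \<beta> (\<alpha> x)"
  shows "(\<lambda>x\<in>carrier G. \<lambda>y\<in>carrier G. \<alpha> x \<otimes> \<beta> y) \<in> assoc_interchange_rings G"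
proof -
  have cl: "\<alpha> x \<in> carrier G" "\<beta> x \<in> carrier G" if "x \<in> carrier G" for x
    using \<alpha> \<beta> that by (auto simp: hom_def)
  show ?thesis
    unfolding assoc_interchange_rings_def interchange_op_def associative_op_def
    using cl hom_mult[OF \<alpha>] hom_mult[OF \<beta>] \<alpha>\<alpha> \<beta>\<beta> \<alpha>\<beta> by (auto simp: m_ac)
qed

text \<open>Joint eigenspace of the two idempotents, where \<open>True\<close> stands for eigenvalue
  1 and \<open>False\<close> for eigenvalue 0.\<close>

definition eigenspace :: "('a \<Rightarrow> 'a \<Rightarrow> 'a) \<Rightarrow> bool \<times> bool \<Rightarrow> 'a set" where
  "eigenspace m s = {x \<in> carrier G. m x \<one> = (if fst s then x else \<one>)
                                \<and> m \<one> x = (if snd s then x else \<one>)}"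

text \<open>An isomorphism fixes \<open>\<one>\<close>, so it intertwines the idempotents of the two
  rings and maps each eigenspace onto its counterpart.\<close>

lemma card_eigenspace_iso:
  assumes m: "m \<in> assoc_interchange_rings G" and f: "interchange_ring_iso G m m' f"
  shows "card (eigenspace m s) = card (eigenspace m' s)"
proof -
  have hom: "f \<in> hom G G" and bij: "bij_betw f (carrier G) (carrier G)"
    and fm: "\<And>x y. \<lbrakk>x \<in> carrier G; y \<in> carrier G\<rbrakk> \<Longrightarrow> m' (f x) (f y) = f (m x y)"
    using f by (auto simp: interchange_ring_iso_def iso_def)
  have one: "f \<one> = \<one>" using hom_one[OF hom] by (simp add: is_group)
  have inj: "inj_on f (carrier G)" using bij by (simp add: bij_betw_def)
  have "f ` eigenspace m s \<subseteq> eigenspace m' s"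
  proof
    fix y assume "y \<in> f ` eigenspace m s"
    then obtain x where x: "x \<in> eigenspace m s" "y = f x" by blast
    then have "m' y \<one> = f (m x \<one>)" "m' \<one> y = f (m \<one> x)" "y \<in> carrier G"
      using fm[of x \<one>] fm[of \<one> x] hom by (auto simp: eigenspace_def one hom_def)
    then show "y \<in> eigenspace m' s" using x one by (auto simp: eigenspace_def)
  qed
  moreover have "eigenspace m' s \<subseteq> f ` eigenspace m s"
  proof
    fix y assume y: "y \<in> eigenspace m' s"
    then obtain x where x: "x \<in> carrier G" "y = f x"
      using bij by (auto simp: eigenspace_def bij_betw_def)
    have cl: "m x \<one> \<in> carrier G" "m \<one> x \<in> carrier G"
      using assoc_interchange_ring_decompose(1,2)[OF m] x by (auto simp: hom_def)
    have "f (m x \<one>) = f (if fst s then x else \<one>)" "f (m \<one> x) = f (if snd s then x else \<one>)"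
      using y fm[of x \<one>] fm[of \<one> x] x by (auto simp: eigenspace_def one)
    then have "m x \<one> = (if fst s then x else \<one>)" "m \<one> x = (if snd s then x else \<one>)"
      using inj_onD[OF inj] cl x by auto
    then show "y \<in> f ` eigenspace m s" using x by (auto simp: eigenspace_def)
  qed
  ultimately have "f ` eigenspace m s = eigenspace m' s" by blast
  moreover have "inj_on f (eigenspace m s)"
    using inj by (rule inj_on_subset) (auto simp: eigenspace_def)
  ultimately show ?thesis by (metis card_image)
qed

end

section \<open>Linear extension, eigenbases and the rings they determine\<close>

context homocyclic_group
begin

text \<open>The chosen coefficients are only determined modulo \<open>q\<close>, which does not affect the
  value when \<open>B\<close> is a basis.\<close>

definition lin :: "'a set \<Rightarrow> ('a \<Rightarrow> 'a) \<Rightarrow> 'a \<Rightarrow> 'a" where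
  "lin B v x = comb (SOME c. comb c id B = x) v B"

lemma basis_carrier: "basis B \<Longrightarrow> id ` B \<subseteq> carrier G"
  by (auto simp: basis_def independent_def)

lemma basis_finite: "basis B \<Longrightarrow> finite B"
  by (auto simp: basis_def independent_finite)

lemma basis_comb:
  assumes "basis B" "x \<in> carrier G"
  obtains c where "x = comb c id B"
  using assms by (auto simp: basis_def span_def)

text \<open>The choice in \<open>lin\<close> is harmless: two coefficient functions of one element
  agree modulo \<open>q\<close>, and \<open>q\<close> kills every value of \<open>v\<close>.\<close>

lemma lin_comb:
  assumes B: "basis B" and v: "v ` B \<subseteq> carrier G"
  shows "lin B v (comb c id B) = comb c v B"
proof -
  define d where "d = (SOME d. comb d id B = comb c id B)"
  have "comb d id B = comb c id B" unfolding d_def by (rule someI[of _ c]) (rule refl)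
  then have "\<forall>b\<in>B. int q dvd d b - c b" using comb_eq_iff B by (simp add: basis_def)
  then have "comb d v B = comb c v B" using v by (intro comb_cong) (auto intro: int_pow_cong_mod)
  then show ?thesis by (simp add: lin_def d_def)
qed

lemma lin_hom:
  assumes B: "basis B" and v: "v ` B \<subseteq> carrier G"
  shows "lin B v \<in> hom G G"
proof (rule homI)
  show "lin B v x \<in> carrier G" if "x \<in> carrier G" for x
    using that v by (simp add: lin_def)
  fix x y assume "x \<in> carrier G" "y \<in> carrier G"
  then obtain c d where "x = comb c id B" "y = comb d id B" using B by (metis basis_comb)
  then show "lin B v (x \<otimes> y) = lin B v x \<otimes> lin B v y"
    by (simp add: comb_mult basis_carrier[OF B, simplified] v lin_comb[OF B v])
qed

definition eigenbasis :: "('a \<Rightarrow> 'a \<Rightarrow> 'a) \<Rightarrow> 'a set \<Rightarrow> ('a \<Rightarrow> bool \<times> bool) \<Rightarrow> bool" where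
  "eigenbasis m B t \<longleftrightarrow> basis B \<and> (\<forall>b\<in>B. b \<in> eigenspace m (t b))"

lemma eigenbasis_exists:
  assumes "m \<in> assoc_interchange_rings G"
  obtains B t where "eigenbasis m B t"
proof -
  note D = assoc_interchange_ring_decompose[OF assms]
  obtain B t where "basis B" "\<forall>b\<in>B. m b \<one> = (if fst (t b) then b else \<one>)
      \<and> m \<one> b = (if snd (t b) then b else \<one>)"
    using eigenbasis_of_commuting_idempotents[OF D(1,2,4,5,6)] by metis
  then have "eigenbasis m B t"
    using basis_carrier[of B] by (auto simp: eigenbasis_def eigenspace_def)
  then show ?thesis by (rule that)
qed

text \<open>In the coordinates of an eigenbasis both idempotents are diagonal with entries 0 and
  1.\<close>

lemma eigenbasis_comb:
  assumes m: "m \<in> assoc_interchange_rings G" and E: "eigenbasis m B t"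
  shows "m (comb c id B) \<one> = comb (\<lambda>b. if fst (t b) then c b else 0) id B"
    and "m \<one> (comb c id B) = comb (\<lambda>b. if snd (t b) then c b else 0) id B"
proof -
  note D = assoc_interchange_ring_decompose[OF m]
  have B: "basis B" using E by (simp add: eigenbasis_def)
  note idB = basis_carrier[OF B]
  have cl: "m b \<one> \<in> carrier G" "m \<one> b \<in> carrier G" if "b \<in> B" for b
    using D(1,2) that idB by (auto simp: hom_def)
  have "m (comb c id B) \<one> = comb c (\<lambda>b. m b \<one>) B"
    using hom_comb[OF D(1) idB basis_finite[OF B]] by simp
  also have "\<dots> = comb c (\<lambda>b. if fst (t b) then id b else \<one>) B"
    using cl E by (intro comb_cong) (auto simp: eigenbasis_def eigenspace_def)
  finally show "m (comb c id B) \<one> = comb (\<lambda>b. if fst (t b) then c b else 0) id B"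
    by (simp only: comb_select[OF idB])
  have "m \<one> (comb c id B) = comb c (\<lambda>b. m \<one> b) B"
    using hom_comb[OF D(2) idB basis_finite[OF B]] by simp
  also have "\<dots> = comb c (\<lambda>b. if snd (t b) then id b else \<one>) B"
    using cl E by (intro comb_cong) (auto simp: eigenbasis_def eigenspace_def)
  finally show "m \<one> (comb c id B) = comb (\<lambda>b. if snd (t b) then c b else 0) id B"
    by (simp only: comb_select[OF idB])
qed

text \<open>The eigenspace is the span of the basis vectors labelled \<open>s\<close>, so it is free
  of that rank.\<close>

lemma card_eigenspace:
  assumes m: "m \<in> assoc_interchange_rings G" and E: "eigenbasis m B t"
  shows "card (eigenspace m s) = q ^ card {b \<in> B. t b = s}"
proof -
  let ?A = "{b \<in> B. t b = s}"
  have B: "basis B" and ind: "independent B" using E by (simp_all add: eigenbasis_def basis_def)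
  note idB = basis_carrier[OF B]
  have restr: "comb (\<lambda>b. if t b = s then c b else 0) id B = comb c id ?A" for c
    unfolding comb_def
    by (rule finprod_mono_neutral_cong_right) (use basis_finite[OF B] idB in auto)
  have "eigenspace m s = span ?A"
  proof (intro subset_antisym subsetI)
    fix x assume x: "x \<in> eigenspace m s"
    then obtain c where c: "x = comb c id B" using basis_comb[OF B] by (auto simp: eigenspace_def)
    have "comb (\<lambda>b. if fst (t b) then c b else 0) id B = comb (\<lambda>b. if fst s then c b else 0) id B"
      using x eigenbasis_comb(1)[OF m E, of c] by (auto simp: eigenspace_def c)
    then have 1: "int q dvd (if fst (t b) then c b else 0) - (if fst s then c b else 0)" if "b \<in> B" for b
      using that by (simp only: comb_eq_iff[OF ind])
    have "comb (\<lambda>b. if snd (t b) then c b else 0) id B = comb (\<lambda>b. if snd s then c b else 0) id B"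
      using x eigenbasis_comb(2)[OF m E, of c] by (auto simp: eigenspace_def c)
    then have 2: "int q dvd (if snd (t b) then c b else 0) - (if snd s then c b else 0)" if "b \<in> B" for b
      using that by (simp only: comb_eq_iff[OF ind])
    \<comment> \<open>If \<open>t b\<close> differs from \<open>s\<close>, it does so in some
      component, and the divisibility for that component says that \<open>q\<close> divides
      \<open>c b\<close>.\<close>
    have "int q dvd c b - (if t b = s then c b else 0)" if "b \<in> B" for b
      using 1[OF that] 2[OF that] by (auto simp: prod_eq_iff split: if_splits)
    then have "x = comb (\<lambda>b. if t b = s then c b else 0) id B"
      unfolding c comb_eq_iff[OF ind] by blast
    then show "x \<in> span ?A" by (auto simp: restr span_def)
  next
    fix x assume "x \<in> span ?A"
    then obtain c where c: "x = comb (\<lambda>b. if t b = s then c b else 0) id B"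
      by (auto simp: span_def simp flip: restr)
    have sel: "comb (\<lambda>b. if P (t b) then (if t b = s then c b else 0) else 0) id B
        = (if P s then x else \<one>)" for P
    proof -
      have "(\<lambda>b. if P (t b) then (if t b = s then c b else 0) else 0)
          = (if P s then (\<lambda>b. if t b = s then c b else 0) else (\<lambda>_. 0))" by auto
      then show ?thesis by (simp add: c)
    qed
    show "x \<in> eigenspace m s"
      using eigenbasis_comb[OF m E, of "\<lambda>b. if t b = s then c b else 0"] sel[of fst] sel[of snd] idB
      by (simp add: eigenspace_def c)
  qed
  then show ?thesis using card_span[OF independent_subset[OF ind, of ?A]] by simp
qed

text \<open>Equal label counts give a label-preserving bijection of the bases. Its linear extension
  commutes with the coordinate selections, hence with both idempotents.\<close>

lemma iso_of_eigenbases: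
  assumes m: "m \<in> assoc_interchange_rings G" and E: "eigenbasis m B t"
    and m': "m' \<in> assoc_interchange_rings G" and E': "eigenbasis m' B' t'"
    and eq: "\<And>s. card {b \<in> B. t b = s} = card {b \<in> B'. t' b = s}"
  shows "\<exists>f. interchange_ring_iso G m m' f"
proof -
  have B: "basis B" and B': "basis B'" using E E' by (simp_all add: eigenbasis_def)
  note idB = basis_carrier[OF B] and idB' = basis_carrier[OF B']
  have "\<exists>g. bij_betw g {b \<in> B. t b = s} {b \<in> B'. t' b = s}" for s
    using eq basis_finite[OF B] basis_finite[OF B'] by (intro finite_same_card_bij) auto
  then obtain g where g: "\<And>s. bij_betw (g s) {b \<in> B. t b = s} {b \<in> B'. t' b = s}" by metis
  define \<phi> where "\<phi> b = g (t b) b" for b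
  have \<phi>: "\<phi> b \<in> B'" "t' (\<phi> b) = t b" if "b \<in> B" for b
    using bij_betwE[OF g[of "t b"]] that by (auto simp: \<phi>_def)
  have bij: "bij_betw \<phi> B B'"
    unfolding bij_betw_def
  proof (intro conjI subset_antisym subsetI)
    show "inj_on \<phi> B"
    proof (rule inj_onI)
      fix a b assume a: "a \<in> B" and b: "b \<in> B" and eq: "\<phi> a = \<phi> b"
      then have tt: "t a = t b" using \<phi> by metis
      then show "a = b" using a b eq bij_betw_imp_inj_on[OF g[of "t b"]]
        by (auto simp: \<phi>_def inj_on_def)
    qed
    fix b' assume b': "b' \<in> B'"
    then have "b' \<in> g (t' b') ` {b \<in> B. t b = t' b'}"
      using bij_betw_imp_surj_on[OF g[of "t' b'"]] by simp
    then obtain b where "b \<in> B" "b' = \<phi> b" by (elim imageE) (auto simp: \<phi>_def)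
    then show "b' \<in> \<phi> ` B" by (rule image_eqI[rotated])
  qed (use \<phi> in auto)
  have \<phi>c: "\<phi> ` B \<subseteq> carrier G" using \<phi> idB' by auto
  note reindex = comb_reindex[OF bij idB', simplified id_apply]
  define f where "f = lin B \<phi>"
  have f_comb: "f (comb c id B) = comb c \<phi> B" for c
    unfolding f_def by (rule lin_comb[OF B \<phi>c])
  have hom: "f \<in> hom G G" unfolding f_def by (rule lin_hom[OF B \<phi>c])
  have "carrier G \<subseteq> f ` carrier G"
  proof
    fix y assume "y \<in> carrier G"
    then obtain c where "y = comb c id B'" using basis_comb[OF B'] by blast
    then have "y = f (comb (\<lambda>b. c (\<phi> b)) id B)" by (simp add: reindex f_comb)
    then show "y \<in> f ` carrier G" using idB by blast
  qed
  then have "f ` carrier G = carrier G" using hom by (auto simp: hom_def)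
  then have "bij_betw f (carrier G) (carrier G)"
    using finite_carrier by (simp add: bij_betw_def finite_surj_inj)
  then have iso: "f \<in> iso G G" using hom by (simp add: iso_def)
  \<comment> \<open>Expressing \<open>f x\<close> in the coordinates of \<open>B'\<close> makes
    \<open>eigenbasis_comb\<close> applicable to \<open>m'\<close>.\<close>
  have reindex': "comb c \<phi> B = comb (\<lambda>b'. c (inv_into B \<phi> b')) id B'" for c
    unfolding reindex using \<phi>c bij by (intro comb_cong) (auto simp: bij_betw_def)
  have f1: "f (m x \<one>) = m' (f x) \<one>" and f2: "f (m \<one> x) = m' \<one> (f x)" if "x \<in> carrier G" for x
  proof -
    obtain c where c: "x = comb c id B" by (rule basis_comb[OF B \<open>x \<in> carrier G\<close>])
    have inv: "inv_into B \<phi> (\<phi> b) = b" if "b \<in> B" for b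
      using that bij by (simp add: bij_betw_def)
    show "f (m x \<one>) = m' (f x) \<one>"
      unfolding c eigenbasis_comb[OF m E] f_comb
      unfolding reindex'[of c] eigenbasis_comb[OF m' E'] unfolding reindex
      using \<phi>c \<phi> inv by (intro comb_cong) auto
    show "f (m \<one> x) = m' \<one> (f x)"
      unfolding c eigenbasis_comb[OF m E] f_comb
      unfolding reindex'[of c] eigenbasis_comb[OF m' E'] unfolding reindex
      using \<phi>c \<phi> inv by (intro comb_cong) auto
  qed
  have "f (m x y) = m' (f x) (f y)" if x: "x \<in> carrier G" and y: "y \<in> carrier G" for x y
  proof -
    have cl: "m x \<one> \<in> carrier G" "m \<one> y \<in> carrier G" "f x \<in> carrier G" "f y \<in> carrier G"
      using assoc_interchange_ring_decompose(1,2)[OF m] hom x y by (auto simp: hom_def)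
    have "f (m x y) = f (m x \<one>) \<otimes> f (m \<one> y)"
      using assoc_interchange_ring_decompose(3)[OF m x y] hom_mult[OF hom cl(1,2)] by simp
    then show ?thesis
      using assoc_interchange_ring_decompose(3)[OF m' cl(3,4)] f1[OF x] f2[OF y] by simp
  qed
  then show ?thesis using iso by (auto simp: interchange_ring_iso_def)
qed

text \<open>For an arbitrary labelling \<open>t\<close>, the projections selecting the vectors with
  true first or second label component are both diagonal in \<open>B\<close>, so they commute and
  define the ring.\<close>

lemma eigenbasis_realize:
  assumes B: "basis B"
  obtains m where "m \<in> assoc_interchange_rings G" "eigenbasis m B t"
proof -
  note idB = basis_carrier[OF B]
  define \<pi> where "\<pi> P = lin B (\<lambda>b. if P (t b) then id b else \<one>)" for P :: "bool \<times> bool \<Rightarrow> bool"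
  have vc: "(\<lambda>b. if P (t b) then id b else \<one>) ` B \<subseteq> carrier G" for P using idB by auto
  have \<pi>_comb: "\<pi> P (comb c id B) = comb (\<lambda>b. if P (t b) then c b else 0) id B" for P c
    unfolding \<pi>_def lin_comb[OF B vc] by (rule comb_select[OF idB])
  have hom: "\<pi> P \<in> hom G G" for P unfolding \<pi>_def by (rule lin_hom[OF B vc])
  \<comment> \<open>Composition of projections is conjunction of predicates, which yields
    idempotence and commutation at once.\<close>
  have \<pi>\<pi>: "\<pi> P (\<pi> Q x) = \<pi> (\<lambda>s. P s \<and> Q s) x" if "x \<in> carrier G" for P Q x
  proof -
    obtain c where c: "x = comb c id B" by (rule basis_comb[OF B \<open>x \<in> carrier G\<close>])
    have "(\<lambda>b. if P (t b) then if Q (t b) then c b else 0 else 0)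
        = (\<lambda>b. if P (t b) \<and> Q (t b) then c b else 0)" by auto
    then show ?thesis unfolding c \<pi>_comb by simp
  qed
  define m where "m = (\<lambda>x\<in>carrier G. \<lambda>y\<in>carrier G. \<pi> fst x \<otimes> \<pi> snd y)"
  have "m \<in> assoc_interchange_rings G" unfolding m_def
    by (rule assoc_interchange_ring_of_idempotents) (simp_all add: hom \<pi>\<pi> conj_commute)
  moreover have "eigenbasis m B t"
    unfolding eigenbasis_def
  proof (intro conjI ballI B)
    fix b assume b: "b \<in> B"
    have bc: "b \<in> carrier G" using b idB by auto
    have b_comb: "b = comb (\<lambda>a. if a = b then 1 else 0) id B"
      using comb_delta[OF basis_finite[OF B] b idB] by simp
    have \<pi>b: "\<pi> P b = (if P (t b) then b else \<one>)" for P
    proof -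
      have "(\<lambda>a. if P (t a) then if a = b then 1 else 0 else 0)
          = (if P (t b) then (\<lambda>a. if a = b then 1 else 0) else (\<lambda>_. 0::int))" by auto
      then show ?thesis using \<pi>_comb[of P "\<lambda>a. if a = b then 1 else 0"] b_comb by simp
    qed
    have "\<pi> P \<one> = \<one>" for P using hom_one[OF hom] by (simp add: is_group)
    then show "b \<in> eigenspace m (t b)" using bc by (simp add: eigenspace_def m_def \<pi>b)
  qed
  ultimately show ?thesis by (rule that)
qed

end

section \<open>Counting classes, fibres and binomial coefficients\<close>

lemma card_quotient_invariant:
  assumes "E \<subseteq> A \<times> A" and "\<And>a b. \<lbrakk>a \<in> A; b \<in> A\<rbrakk> \<Longrightarrow> (a, b) \<in> E \<longleftrightarrow> f a = f b"
  shows "card (A // E) = card (f ` A)"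
proof -
  have cls: "E `` {a} = {b \<in> A. f b = f a}" if "a \<in> A" for a
    using assms that by fastforce
  have "A // E = (\<lambda>v. {b \<in> A. f b = v}) ` f ` A"
    by (auto simp: quotient_def image_iff cls)
  moreover have "inj_on (\<lambda>v. {b \<in> A. f b = v}) (f ` A)"
    by (rule inj_onI) blast
  ultimately show ?thesis by (simp add: card_image)
qed

lemma sum_card_fibres:
  fixes t :: "'a \<Rightarrow> 's::finite"
  assumes "finite B"
  shows "(\<Sum>s\<in>UNIV. card {b \<in> B. t b = s}) = card B"
  using sum.group[OF assms finite[of UNIV] subset_UNIV, where g = t and h = "\<lambda>_. 1::nat"] by simp

text \<open>Identify \<open>B\<close> with a disjoint union of blocks of sizes \<open>k s\<close>
  and let \<open>t\<close> be the block index.\<close>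

lemma function_with_fibre_cards:
  fixes k :: "'s::finite \<Rightarrow> nat"
  assumes "finite B" and "card B = sum k UNIV"
  obtains t where "\<And>s. card {b \<in> B. t b = s} = k s"
proof -
  have "card B = card (SIGMA s:UNIV. {..<k s})" using assms by (simp add: card_SigmaI)
  then obtain g where g: "bij_betw g B (SIGMA s:UNIV. {..<k s})"
    using finite_same_card_bij[of B "SIGMA s:UNIV. {..<k s}"] assms(1) by auto
  have "card {b \<in> B. fst (g b) = s} = k s" for s
  proof -
    have "g ` {b \<in> B. fst (g b) = s} = {x \<in> g ` B. fst x = s}" by blast
    also have "\<dots> = {s} \<times> {..<k s}" unfolding bij_betw_imp_surj_on[OF g] by auto
    finally have "bij_betw g {b \<in> B. fst (g b) = s} ({s} \<times> {..<k s})"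
      by (intro bij_betw_subset[OF g]) auto
    then show ?thesis by (simp add: bij_betw_same_card)
  qed
  then show ?thesis by (rule that)
qed

lemma choose_three: "(r + 3) choose 3 = (r + 1) * (r + 2) * (r + 3) div 6"
proof -
  have "6 * ((r + 3) choose 3) = (r + 1) * (r + 2) * (r + 3)"
    using Suc_times_binomial_eq[of "r + 2" 2] Suc_times_binomial_eq[of "r + 1" 1]
    by (simp add: numeral_eq_Suc algebra_simps)
  then show ?thesis by (metis nonzero_mult_div_cancel_left zero_neq_numeral)
qed

section \<open>The number of isomorphism classes\<close>

context homocyclic_group
begin

text \<open>The trivial endomorphism, taken twice, is a pair of commuting idempotents.\<close>

lemma basis_exists: obtains B where "basis B"
proof -
  have "(\<lambda>_. \<one>) \<in> hom G G" by (simp add: hom_def)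
  then show ?thesis
    using eigenbasis_of_commuting_idempotents[of "\<lambda>_. \<one>" "\<lambda>_. \<one>"] that by blast
qed

text \<open>A fixed order of the labels turns invariants into lists, which can be counted by length
  and sum.\<close>

definition types :: "(bool \<times> bool) list" where
  "types = [(True, True), (True, False), (False, True), (False, False)]"

lemma types: "distinct types" "set types = UNIV" "length types = 4"
  by (auto simp: types_def)

text \<open>Cardinalities encode the ranks as powers of \<open>q\<close>, without reference to a
  chosen eigenbasis.\<close>

definition eigenspace_cards :: "('a \<Rightarrow> 'a \<Rightarrow> 'a) \<Rightarrow> nat list" where
  "eigenspace_cards m = map (\<lambda>s. card (eigenspace m s)) types"

lemma sum_list_types: "sum_list (map k types) = sum k UNIV"
  using types by (metis sum_list_distinct_conv_sum_set)

lemma eigenspace_cards_eq_iff: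
  "eigenspace_cards m = eigenspace_cards m'
    \<longleftrightarrow> (\<forall>s. card (eigenspace m s) = card (eigenspace m' s))"
  by (simp add: eigenspace_cards_def types(2))

text \<open>For the converse, \<open>q > 1\<close> lets the ranks be read off from the
  cardinalities, and equal ranks allow the eigenbases to be matched.\<close>

lemma isomorphic_iff:
  assumes m: "m \<in> assoc_interchange_rings G" and m': "m' \<in> assoc_interchange_rings G"
  shows "(m, m') \<in> interchange_ring_isomorphic G \<longleftrightarrow> eigenspace_cards m = eigenspace_cards m'"
proof
  assume "(m, m') \<in> interchange_ring_isomorphic G"
  then show "eigenspace_cards m = eigenspace_cards m'"
    using card_eigenspace_iso[OF m] by (auto simp: interchange_ring_isomorphic_def eigenspace_cards_eq_iff)
next
  assume eq: "eigenspace_cards m = eigenspace_cards m'"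
  obtain B t where E: "eigenbasis m B t" by (rule eigenbasis_exists[OF m])
  obtain B' t' where E': "eigenbasis m' B' t'" by (rule eigenbasis_exists[OF m'])
  have "card {b \<in> B. t b = s} = card {b \<in> B'. t' b = s}" for s
    using eq card_eigenspace[OF m E, of s] card_eigenspace[OF m' E', of s] q_gt_1
    by (metis eigenspace_cards_eq_iff power_inject_exp)
  then show "(m, m') \<in> interchange_ring_isomorphic G"
    using iso_of_eigenbases[OF m E m' E'] m m' by (auto simp: interchange_ring_isomorphic_def)
qed

text \<open>The ranks add up to the size of a basis. Conversely, a basis can be labelled with any
  prescribed counts of sum \<open>r\<close> and the labelling realised by a ring.\<close>

lemma eigenspace_cards_image:
  "eigenspace_cards ` assoc_interchange_rings G
    = map (\<lambda>k. q ^ k) ` {l. length l = 4 \<and> sum_list l = r}" (is "_ = _ ` ?L")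
proof (intro subset_antisym subsetI)
  fix v assume "v \<in> eigenspace_cards ` assoc_interchange_rings G"
  then obtain m where m: "m \<in> assoc_interchange_rings G" and v: "v = eigenspace_cards m" by blast
  obtain B t where E: "eigenbasis m B t" by (rule eigenbasis_exists[OF m])
  then have B: "basis B" by (simp add: eigenbasis_def)
  let ?l = "map (\<lambda>s. card {b \<in> B. t b = s}) types"
  have "v = map (\<lambda>k. q ^ k) ?l"
    using card_eigenspace[OF m E] by (simp add: v eigenspace_cards_def)
  moreover have "?l \<in> ?L"
    using sum_card_fibres[OF basis_finite[OF B], of t] card_basis[OF B]
    by (simp add: sum_list_types types(3))
  ultimately show "v \<in> map (\<lambda>k. q ^ k) ` ?L" by blast
next
  fix v assume "v \<in> map (\<lambda>k. q ^ k) ` ?L"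
  then obtain l where l: "length l = 4" "sum_list l = r" and v: "v = map (\<lambda>k. q ^ k) l" by blast
  define k where "k s = the (map_of (zip types l) s)" for s
  have kl: "map k types = l"
    by (rule nth_equalityI) (simp_all add: k_def types l map_of_zip_nth)
  obtain B where B: "basis B" by (rule basis_exists)
  have "card B = sum k UNIV" using card_basis[OF B] l kl sum_list_types[of k] by simp
  then obtain t where t: "\<And>s. card {b \<in> B. t b = s} = k s"
    using function_with_fibre_cards[OF basis_finite[OF B]] by metis
  obtain m where m: "m \<in> assoc_interchange_rings G" and E: "eigenbasis m B t"
    by (rule eigenbasis_realize[OF B])
  have "eigenspace_cards m = map (\<lambda>k. q ^ k) (map k types)"
    by (simp add: eigenspace_cards_def card_eigenspace[OF m E] t)
  then show "v \<in> eigenspace_cards ` assoc_interchange_rings G" using m unfolding v kl by (metis image_eqI)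
qed

theorem card_isomorphism_classes:
  "card (assoc_interchange_rings G // interchange_ring_isomorphic G)
    = (r + 1) * (r + 2) * (r + 3) div 6"
proof -
  have "card (assoc_interchange_rings G // interchange_ring_isomorphic G)
      = card (eigenspace_cards ` assoc_interchange_rings G)"
    by (rule card_quotient_invariant[OF _ isomorphic_iff]) (auto simp: interchange_ring_isomorphic_def)
  also have "\<dots> = card {l :: nat list. length l = 4 \<and> sum_list l = r}"
    unfolding eigenspace_cards_image
  proof (rule card_image)
    have "inj (\<lambda>k. q ^ k)" using q_gt_1 by (intro injI) simp
    then show "inj_on (map (\<lambda>k. q ^ k)) {l. length l = 4 \<and> sum_list l = r}"
      by (meson inj_mapI inj_on_subset subset_UNIV)
  qed
  \<comment> \<open>Stars and bars for four summands.\<close>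
  also have "\<dots> = (r + 3) choose r" by (simp add: card_length_sum_list add.commute)
  also have "\<dots> = (r + 3) choose 3" using binomial_symmetric[of r "r + 3"] by simp
  finally show ?thesis by (simp only: choose_three)
qed

end

section \<open>Direct sums of cyclic groups of order p^n are homocyclic\<close>

lemma elem_abelian_group_pow:
  assumes "x \<in> carrier (elem_abelian_group p n r)" "p > 0"
  shows "x [^]\<^bsub>elem_abelian_group p n r\<^esub> (k::nat) = (\<lambda>i\<in>{..<r}. (int k * x i) mod int (p ^ n))"
proof (induction k)
  case 0
  then show ?case by (simp add: elem_abelian_group_def)
next
  case (Suc k)
  then show ?case
    by (auto simp: elem_abelian_group_def algebra_simps mod_simps simp del: of_nat_power)
qed

text \<open>All conditions are checked in coordinates. For \<open>socle\<close>, p * a = 0 modulo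
  p^n means that p^(n-1) divides a, so each coordinate can be divided by p^(n-1).\<close>

lemma homocyclic_group_of_iso:
  fixes G (structure)
  assumes p: "Factorial_Ring.prime p" and n: "n \<ge> 1" and G: "comm_group G"
    and iso: "G \<cong> elem_abelian_group p n r"
  shows "homocyclic_group G p n r"
proof -
  interpret comm_group G by (rule G)
  let ?E = "elem_abelian_group p n r"
  have p0: "p > 0" using p by (rule prime_gt_0_nat)
  have grpE: "Group.group ?E" by (simp add: elem_abelian_group_def)
  have carE: "carrier ?E = {..<r} \<rightarrow>\<^sub>E {0..<int (p ^ n)}"
    using p0 by (simp add: elem_abelian_group_def carrier_integer_mod_group)
  have oneE: "\<one>\<^bsub>?E\<^esub> = (\<lambda>i\<in>{..<r}. 0)" by (simp add: elem_abelian_group_def)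
  obtain h where "h \<in> iso G ?E" using iso by (auto simp: is_iso_def)
  then have hom: "h \<in> hom G ?E" and bij: "bij_betw h (carrier G) (carrier ?E)" by (auto simp: iso_def)
  have hcl: "h x \<in> carrier ?E" if "x \<in> carrier G" for x using hom that by (auto simp: hom_def)
  have h_pow: "h (x [^] k) = (\<lambda>i\<in>{..<r}. (int k * h x i) mod int (p ^ n))"
    if "x \<in> carrier G" for x and k :: nat
    using hom_nat_pow[OF hom that is_group grpE, of k] elem_abelian_group_pow[OF hcl[OF that] p0] by simp
  have h_one: "h \<one> = (\<lambda>i\<in>{..<r}. 0)" using hom_one[OF hom is_group grpE] by (simp add: oneE)
  have inj: "x = y" if "h x = h y" "x \<in> carrier G" "y \<in> carrier G" for x y
    using bij that by (auto simp: bij_betw_def inj_on_def)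
  show ?thesis
  proof (unfold_locales)
    show "Factorial_Ring.prime p" "n \<ge> 1" by fact+
    have "finite (carrier ?E)" by (simp add: carE finite_PiE)
    then show "finite (carrier G)" using bij bij_betw_finite by blast
    show "card (carrier G) = (p ^ n) ^ r"
      using bij_betw_same_card[OF bij] by (simp add: carE card_PiE nat_power_eq)
    show "x [^] (p ^ n) = \<one>" if "x \<in> carrier G" for x
      using that by (intro inj) (auto simp: h_pow h_one simp del: of_nat_power)
    fix x assume x: "x \<in> carrier G" and xp: "x [^] p = \<one>"
    have pn: "int (p ^ n) = int p * int (p ^ (n - 1))" using n by (cases n) auto
    have dvd: "int (p ^ (n - 1)) dvd h x i" if "i < r" for i
    proof -
      have "h (x [^] p) i = 0" using h_one that by (simp add: xp)
      then have "int p * int (p ^ (n - 1)) dvd int p * h x i"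
        using that by (simp only: h_pow[OF x] restrict_apply lessThan_iff if_True mod_eq_0_iff_dvd pn)
      then show ?thesis using p0 by simp
    qed
    define z where "z = (\<lambda>i\<in>{..<r}. h x i div int (p ^ (n - 1)))"
    have hx: "0 \<le> h x i" "h x i < int (p ^ n)" if "i < r" for i
      using hcl[OF x] that unfolding carE by (auto simp: PiE_iff)
    have "z \<in> carrier ?E"
      unfolding carE z_def
    proof (rule restrict_PiE_iff[THEN iffD2], rule ballI)
      fix i assume "i \<in> {..<r}"
      then have i: "i < r" by simp
      have "h x i div int (p ^ (n - 1)) \<le> h x i"
        using zdiv_mono2[of "h x i" 1 "int (p ^ (n - 1))"] hx(1)[OF i] p0 by simp
      moreover have "0 \<le> h x i div int (p ^ (n - 1))" using hx(1)[OF i] p0 by (simp add: pos_imp_zdiv_nonneg_iff)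
      ultimately show "h x i div int (p ^ (n - 1)) \<in> {0..<int (p ^ n)}" using hx(2)[OF i] by simp
    qed
    then obtain y where y: "y \<in> carrier G" "h y = z" using bij_betw_imp_surj_on[OF bij] by (metis imageE)
    have "h x = h (y [^] (p ^ (n - 1)))"
    proof
      fix i
      show "h x i = h (y [^] (p ^ (n - 1))) i"
      proof (cases "i < r")
        case True
        then show ?thesis using dvd[OF True] hx[OF True]
          by (simp add: h_pow[OF y(1)] y(2) z_def del: of_nat_power)
      next
        \<comment> \<open>Outside the index range both sides are \<open>undefined\<close> by
          extensionality.\<close>
        case False
        then show ?thesis using hcl[OF x] unfolding carE
          by (auto simp: h_pow[OF y(1)] PiE_iff extensional_def)
      qed
    qed
    then show "\<exists>y\<in>carrier G. x = y [^] (p ^ (n - 1))" using x y inj by blast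
  qed
qed

theorem theorem6p9:
  fixes G :: "'a monoid" and p n r :: nat
  assumes "Factorial_Ring.prime p" and "n \<ge> 1" and "r \<ge> 1"
    and "comm_group G"
    and "G \<cong> elem_abelian_group p n r"
  shows "card (assoc_interchange_rings G // interchange_ring_isomorphic G)
           = (r + 1) * (r + 2) * (r + 3) div 6"
  by (rule homocyclic_group.card_isomorphism_classes) (rule homocyclic_group_of_iso; fact)

end
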